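(* Every acyclic weakly l.f.g.u. monoid is FmF-atomic.
   Context: Let $H$ be a (multiplicatively written) monoid with identity $1_H$ and group of units $H^\times$. $H$ is acyclic if $uxv \ne x$ for all $u, v, x \in H$ such that $u$ or $v$ is a non-unit. For $x,y \in H$ write $x \mid_H y$ ("$x$ is a divisor of $y$ in $H$") if $y \in HxH$; this is a preorder on $H$. Elements $x,y$ are $\mid_H$-equivalent if $x \mid_H y \mid_H x$. A $\mid_H$-unit is an element $\mid_H$-equivalent to $1_H$; other elements are $\mid_H$-non-units. A $\mid_H$-atom is a $\mid_H$-non-unit that is not a product of two $\mid_H$-non-units. An irreducible of $H$ is a $\mid_H$-non-unit $a$ such that $a \neq xy$ for all $\mid_H$-non-units $x,y$ with $x \mid_H a$, $a \nmid_H x$, $y \mid_H a$, $a \nmid_H y$. $H$ is weakly l.f.g.u. if, for every $\mid_H$-non-unit $x$, letting $K$ be the submonoid of $H$ generated by all the divisors of $x$ in $H$ and $U$ the set of $\mid_H$-units of $H$ that lie in $K$, there is a finite $A \subseteq K$ such that $K$ is generated as a monoid by $UAU$. A $\mid_H$-factorization of $x$ is a finite word (tuple) of irreducibles of $H$ whose letters multiply, in order, to $x$. For finite words $\mathfrak a = a_1 \ast \cdots \ast a_m$ and $\mathfrak b = b_1 \ast \cdots \ast b_n$ of elements of $H$, write $\mathfrak a \sqsubseteq \mathfrak b$ if there is an injective $\sigma \colon \{1,\ldots,m\} \to \{1,\ldots,n\}$ such that $a_i$ is $\mid_H$-equivalent to $b_{\sigma(i)}$ for every $i$; words are $\sqsubseteq$-equivalent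 if $\mathfrak a \sqsubseteq \mathfrak b \sqsubseteq \mathfrak a$. A $\mid_H$-factorization $\mathfrak a$ of $x$ is minimal if there is no $\mid_H$-factorization $\mathfrak b$ of $x$ with $\mathfrak b \sqsubseteq \mathfrak a$ and not $\mathfrak a \sqsubseteq \mathfrak b$; it is a minimal atomic $\mid_H$-factorization if, in addition, all its letters are $\mid_H$-atoms. $H$ is FmF-atomic if, for every $\mid_H$-non-unit $x$, the set of minimal atomic $\mid_H$-factorizations of $x$ is non-empty and has finitely many $\sqsubseteq$-equivalence classes. *)

theory Defs
  imports "HOL-Algebra.Coset"
begin

text \<open>
  The library's divisibility on monoids (theory Divisibility) is one-sided,
  \<open>b \<in> aG\<close>, and is meant for commutative monoids. The notions below rest on the two-sided
  relation \<open>b \<in> GaG\<close> in a monoid that need not be commutative.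
\<close>

definition acyclic_monoid :: "('a, 'b) monoid_scheme \<Rightarrow> bool" where
  "acyclic_monoid G \<longleftrightarrow>
    (\<forall>u \<in> carrier G. \<forall>v \<in> carrier G. \<forall>x \<in> carrier G.
       u \<notin> Units G \<or> v \<notin> Units G \<longrightarrow> u \<otimes>\<^bsub>G\<^esub> x \<otimes>\<^bsub>G\<^esub> v \<noteq> x)"

definition bdivides :: "('a, 'b) monoid_scheme \<Rightarrow> 'a \<Rightarrow> 'a \<Rightarrow> bool" where
  "bdivides G x y \<longleftrightarrow> (\<exists>u \<in> carrier G. \<exists>v \<in> carrier G. y = u \<otimes>\<^bsub>G\<^esub> x \<otimes>\<^bsub>G\<^esub> v)"

definition bdiv_equiv :: "('a, 'b) monoid_scheme \<Rightarrow> 'a \<Rightarrow> 'a \<Rightarrow> bool" where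
  "bdiv_equiv G x y \<longleftrightarrow> bdivides G x y \<and> bdivides G y x"

definition bdiv_units :: "('a, 'b) monoid_scheme \<Rightarrow> 'a set" where
  "bdiv_units G = {x \<in> carrier G. bdiv_equiv G x \<one>\<^bsub>G\<^esub>}"

definition bdiv_nonunits :: "('a, 'b) monoid_scheme \<Rightarrow> 'a set" where
  "bdiv_nonunits G = carrier G - bdiv_units G"

definition bdiv_atoms :: "('a, 'b) monoid_scheme \<Rightarrow> 'a set" where
  "bdiv_atoms G =
    {a \<in> bdiv_nonunits G. \<forall>x \<in> bdiv_nonunits G. \<forall>y \<in> bdiv_nonunits G. a \<noteq> x \<otimes>\<^bsub>G\<^esub> y}"

definition bdiv_irreducibles :: "('a, 'b) monoid_scheme \<Rightarrow> 'a set" where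
  "bdiv_irreducibles G =
    {a \<in> bdiv_nonunits G. \<forall>x \<in> bdiv_nonunits G. \<forall>y \<in> bdiv_nonunits G.
       bdivides G x a \<and> \<not> bdivides G a x \<and> bdivides G y a \<and> \<not> bdivides G a y
       \<longrightarrow> a \<noteq> x \<otimes>\<^bsub>G\<^esub> y}"

definition submonoid_generated :: "('a, 'b) monoid_scheme \<Rightarrow> 'a set \<Rightarrow> 'a set" where
  "submonoid_generated G S = \<Inter> {K. submonoid K G \<and> S \<subseteq> K}"

definition divisor_submonoid :: "('a, 'b) monoid_scheme \<Rightarrow> 'a \<Rightarrow> 'a set" where
  "divisor_submonoid G x = submonoid_generated G {y \<in> carrier G. bdivides G y x}"

text \<open>
  Here \<open>U\<close> is the set of those elements of \<open>K\<close> that divide the identity in \<open>G\<close>; they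
  need not divide it in \<open>K\<close>.
\<close>

definition weakly_lfgu :: "('a, 'b) monoid_scheme \<Rightarrow> bool" where
  "weakly_lfgu G \<longleftrightarrow>
    (\<forall>x \<in> bdiv_nonunits G.
       let K = divisor_submonoid G x; U = bdiv_units G \<inter> K
       in \<exists>A. finite A \<and> A \<subseteq> K \<and> K = submonoid_generated G (U <#>\<^bsub>G\<^esub> A <#>\<^bsub>G\<^esub> U))"

definition word_prod :: "('a, 'b) monoid_scheme \<Rightarrow> 'a list \<Rightarrow> 'a" where
  "word_prod G as = foldr (\<otimes>\<^bsub>G\<^esub>) as \<one>\<^bsub>G\<^esub>"

definition bdiv_factorizations :: "('a, 'b) monoid_scheme \<Rightarrow> 'a \<Rightarrow> 'a list set" where
  "bdiv_factorizations G x = {as. set as \<subseteq> bdiv_irreducibles G \<and> word_prod G as = x}"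

definition word_le :: "('a, 'b) monoid_scheme \<Rightarrow> 'a list \<Rightarrow> 'a list \<Rightarrow> bool" where
  "word_le G as bs \<longleftrightarrow>
    (\<exists>\<sigma>. inj_on \<sigma> {..<length as} \<and> \<sigma> ` {..<length as} \<subseteq> {..<length bs} \<and>
         (\<forall>i < length as. bdiv_equiv G (as ! i) (bs ! \<sigma> i)))"

definition minimal_factorizations :: "('a, 'b) monoid_scheme \<Rightarrow> 'a \<Rightarrow> 'a list set" where
  "minimal_factorizations G x =
    {as \<in> bdiv_factorizations G x.
       \<not> (\<exists>bs \<in> bdiv_factorizations G x. word_le G bs as \<and> \<not> word_le G as bs)}"

text \<open>Minimality is tested against all factorizations into irreducibles, not only atomic ones.\<close>

definition minimal_atomic_factorizations :: "('a, 'b) monoid_scheme \<Rightarrow> 'a \<Rightarrow> 'a list set" where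
  "minimal_atomic_factorizations G x =
    {as \<in> minimal_factorizations G x. set as \<subseteq> bdiv_atoms G}"

definition word_equiv_on :: "('a, 'b) monoid_scheme \<Rightarrow> 'a list set \<Rightarrow> ('a list \<times> 'a list) set" where
  "word_equiv_on G Z = {(as, bs) \<in> Z \<times> Z. word_le G as bs \<and> word_le G bs as}"

definition FmF_atomic :: "('a, 'b) monoid_scheme \<Rightarrow> bool" where
  "FmF_atomic G \<longleftrightarrow>
    (\<forall>x \<in> bdiv_nonunits G.
       let Z = minimal_atomic_factorizations G x
       in Z \<noteq> {} \<and> finite (Z // word_equiv_on G Z))"

end

theory Submission
  imports Complex_Main Defs "HOL-Combinatorics.List_Permutation"
begin

text \<open>
  In an acyclic monoid the divisors of \<open>\<one>\<close> are units, equivalent elements differ by units on both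
  sides, and every irreducible is an atom. Let \<open>x\<close> be a non-unit and \<open>A\<close> a finite set that, up to
  units, generates the submonoid of the divisors of \<open>x\<close>. Since strict divisibility is well founded
  on \<open>A\<close>, every element of \<open>A\<close> is a unit or a product of atoms, and hence so is \<open>x\<close>; a
  factorization of least length is then minimal. Each atom dividing \<open>x\<close> is equivalent to an element
  of \<open>A\<close>, so a factorization of \<open>x\<close> amounts to a multiset over a finite set, and Dickson's lemma
  leaves only finitely many classes of minimal ones.
\<close>

section \<open>Dickson's lemma\<close>

text \<open>A monotone subsequence exists in any case; a decreasing one of natural numbers is
  constant once it reaches its least value, so dropping the terms before that leaves a nondecreasing
  one.\<close>

lemma nat_mono_subseq:
  fixes s :: "nat \<Rightarrow> nat"
  obtains \<phi> :: "nat \<Rightarrow> nat" where "strict_mono \<phi>" "mono (s \<circ> \<phi>)"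
proof -
  obtain \<phi> :: "nat \<Rightarrow> nat" where \<phi>: "strict_mono \<phi>" "monoseq (\<lambda>n. s (\<phi> n))"
    using seq_monosub by blast
  show thesis
  proof (cases "incseq (\<lambda>n. s (\<phi> n))")
    case True
    then show thesis using \<phi>(1) that[of \<phi>] by (simp add: comp_def)
  next
    case False
    then have dec: "decseq (\<lambda>n. s (\<phi> n))" using \<phi>(2) monoseq_iff by blast
    obtain N where N: "\<And>n. s (\<phi> N) \<le> s (\<phi> n)"
      using ex_has_least_nat[of "\<lambda>_. True" 0 "\<lambda>n. s (\<phi> n)"] by blast
    have const: "s (\<phi> (n + N)) = s (\<phi> N)" for n
      using N[of "n + N"] decseqD[OF dec, of N "n + N"] by simp
    have "strict_mono (\<lambda>n. \<phi> (n + N))"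
      using \<phi>(1) by (simp add: strict_mono_def)
    then show thesis using that[of "\<lambda>n. \<phi> (n + N)"] const by (simp add: mono_def)
  qed
qed

text \<open>The subsequence is thinned once for each element of \<open>A\<close>; further thinning
  keeps the monotonicity already gained.\<close>

lemma dickson_subseq:
  fixes m :: "nat \<Rightarrow> 'a \<Rightarrow> nat"
  assumes "finite A"
  shows "\<exists>\<phi> :: nat \<Rightarrow> nat. strict_mono \<phi> \<and> (\<forall>a\<in>A. mono (\<lambda>n. m (\<phi> n) a))"
  using assms
proof induction
  case empty
  show ?case by (rule exI[of _ id]) (simp add: strict_mono_def)
next
  case (insert a A)
  then obtain \<phi> :: "nat \<Rightarrow> nat" where \<phi>: "strict_mono \<phi>" "\<forall>b\<in>A. mono (\<lambda>n. m (\<phi> n) b)" by blast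
  obtain \<psi> :: "nat \<Rightarrow> nat" where \<psi>: "strict_mono \<psi>" "mono ((\<lambda>n. m (\<phi> n) a) \<circ> \<psi>)"
    using nat_mono_subseq by blast
  have "mono (\<lambda>n. m ((\<phi> \<circ> \<psi>) n) b)" if "b \<in> A" for b
    using \<phi>(2) that strict_mono_mono[OF \<psi>(1)] by (simp add: mono_def)
  moreover have "strict_mono (\<phi> \<circ> \<psi>)" using \<phi>(1) \<psi>(1) by (rule strict_mono_o)
  ultimately show ?case using \<psi>(2) by (intro exI[of _ "\<phi> \<circ> \<psi>"]) (simp add: comp_def)
qed

text \<open>A multiset over \<open>A\<close> is its vector of multiplicities, so two terms of a
  subsequence that is monotone in every coordinate are comparable.\<close>

lemma dickson_mset:
  fixes m :: "nat \<Rightarrow> 'a multiset"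
  assumes "finite A" "\<And>n. set_mset (m n) \<subseteq> A"
  obtains i j where "i < j" "m i \<subseteq># m j"
proof -
  obtain \<phi> :: "nat \<Rightarrow> nat"
    where \<phi>: "strict_mono \<phi>" "\<And>a. a \<in> A \<Longrightarrow> mono (\<lambda>n. count (m (\<phi> n)) a)"
    using dickson_subseq[OF assms(1), of "\<lambda>n. count (m n)"] by blast
  have "count (m (\<phi> 0)) a \<le> count (m (\<phi> 1)) a" for a
  proof (cases "a \<in> A")
    case True
    show ?thesis using monoD[OF \<phi>(2)[OF True], of 0 1] by simp
  next
    case False
    then have "a \<notin># m (\<phi> 0)" using assms(2) by blast
    then show ?thesis by (simp add: not_in_iff)
  qed
  then have "m (\<phi> 0) \<subseteq># m (\<phi> 1)" by (simp add: subseteq_mset_def)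
  moreover have "\<phi> 0 < \<phi> 1" using \<phi>(1) by (simp add: strict_mono_def)
  ultimately show thesis using that by blast
qed

text \<open>Padding \<open>xs\<close> with the missing elements makes it a permutation of
  \<open>ys\<close>; the bijection between positions, restricted to those of \<open>xs\<close>, has
  the shape that \<open>word_le\<close> asks for.\<close>

lemma mset_subset_Ex_inj:
  assumes "mset xs \<subseteq># mset ys"
  shows "\<exists>\<sigma>. inj_on \<sigma> {..<length xs} \<and> \<sigma> ` {..<length xs} \<subseteq> {..<length ys} \<and>
    (\<forall>i<length xs. xs ! i = ys ! \<sigma> i)"
proof -
  obtain zs where "mset zs = mset ys - mset xs" using ex_mset by blast
  with assms have "mset (xs @ zs) = mset ys" by simp
  then obtain f where f: "bij_betw f {..<length (xs @ zs)} {..<length ys}"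
    "\<forall>i<length (xs @ zs). (xs @ zs) ! i = ys ! f i"
    using permutation_Ex_bij[of "xs @ zs" ys] by blast
  have sub: "{..<length xs} \<subseteq> {..<length (xs @ zs)}" by auto
  have "inj_on f {..<length xs}"
    using bij_betw_imp_inj_on[OF f(1)] sub by (rule inj_on_subset)
  moreover have "f ` {..<length xs} \<subseteq> {..<length ys}"
    using image_mono[OF sub, of f] bij_betw_imp_surj_on[OF f(1)] by simp
  moreover have "xs ! i = ys ! f i" if "i < length xs" for i
    using f(2) that by (metis length_append nth_append trans_less_add1)
  ultimately show ?thesis by blast
qed

section \<open>Words and two-sided divisibility\<close>

lemma word_prod_Nil [simp]: "word_prod G [] = \<one>\<^bsub>G\<^esub>"
  and word_prod_Cons [simp]: "word_prod G (a # as) = a \<otimes>\<^bsub>G\<^esub> word_prod G as"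
  by (simp_all add: word_prod_def)

text \<open>Serves as induction principle for generated submonoids: a property is proved for all
  elements by showing that the elements having it form a submonoid that contains the
  generators.\<close>

lemma submonoid_generated_minimal:
  assumes "submonoid K G" "S \<subseteq> K"
  shows "submonoid_generated G S \<subseteq> K"
  using assms unfolding submonoid_generated_def by blast

lemma submonoid_generated_incl: "S \<subseteq> submonoid_generated G S"
  unfolding submonoid_generated_def by blast

lemma divisor_submonoid_incl:
  "y \<in> carrier G \<Longrightarrow> bdivides G y x \<Longrightarrow> y \<in> divisor_submonoid G x"
  using submonoid_generated_incl[of "{y \<in> carrier G. bdivides G y x}" G]
  unfolding divisor_submonoid_def by blast

context monoid
begin

lemma carrier_submonoid: "submonoid (carrier G) G"
  by (simp add: submonoid_def)

lemma word_prod_closed [simp]: "set as \<subseteq> carrier G \<Longrightarrow> word_prod G as \<in> carrier G"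
  by (induction as) auto

lemma word_prod_append:
  "set as \<subseteq> carrier G \<Longrightarrow> set bs \<subseteq> carrier G \<Longrightarrow>
    word_prod G (as @ bs) = word_prod G as \<otimes> word_prod G bs"
  by (induction as) (auto simp: m_assoc)

section \<open>Two-sided divisibility and its equivalence\<close>

lemma bdividesI:
  "u \<in> carrier G \<Longrightarrow> v \<in> carrier G \<Longrightarrow> y = u \<otimes> x \<otimes> v \<Longrightarrow> bdivides G x y"
  unfolding bdivides_def by blast

lemma bdivides_refl: "x \<in> carrier G \<Longrightarrow> bdivides G x x"
  by (rule bdividesI[of \<one> \<one>]) auto

lemma bdivides_trans:
  assumes "x \<in> carrier G" "bdivides G x y" "bdivides G y z"
  shows "bdivides G x z"
proof -
  obtain u v s t where "u \<in> carrier G" "v \<in> carrier G" "s \<in> carrier G" "t \<in> carrier G"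
    "y = u \<otimes> x \<otimes> v" "z = s \<otimes> y \<otimes> t"
    using assms(2,3) unfolding bdivides_def by blast
  with assms(1) show ?thesis
    by (intro bdividesI[of "s \<otimes> u" "v \<otimes> t"]) (simp_all add: m_assoc)
qed

lemma bdivides_mult_left: "x \<in> carrier G \<Longrightarrow> y \<in> carrier G \<Longrightarrow> bdivides G x (x \<otimes> y)"
  by (rule bdividesI[of \<one> y]) auto

lemma bdivides_mult_right: "x \<in> carrier G \<Longrightarrow> y \<in> carrier G \<Longrightarrow> bdivides G y (x \<otimes> y)"
  by (rule bdividesI[of x \<one>]) auto

lemma word_prod_letter_bdivides:
  "set as \<subseteq> carrier G \<Longrightarrow> a \<in> set as \<Longrightarrow> bdivides G a (word_prod G as)"
proof (induction as)
  case (Cons b bs)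
  then show ?case
    using bdivides_mult_left[of b "word_prod G bs"]
      bdivides_trans[OF _ _ bdivides_mult_right[of b "word_prod G bs"], of a]
    by auto
qed simp

lemma bdiv_equiv_refl: "x \<in> carrier G \<Longrightarrow> bdiv_equiv G x x"
  unfolding bdiv_equiv_def by (simp add: bdivides_refl)

lemma bdiv_equiv_sym: "bdiv_equiv G x y \<Longrightarrow> bdiv_equiv G y x"
  unfolding bdiv_equiv_def by simp

lemma bdiv_equiv_trans:
  "x \<in> carrier G \<Longrightarrow> z \<in> carrier G \<Longrightarrow> bdiv_equiv G x y \<Longrightarrow> bdiv_equiv G y z \<Longrightarrow> bdiv_equiv G x z"
  unfolding bdiv_equiv_def by (meson bdivides_trans)

lemma bdiv_equiv_Units_mult:
  assumes "u \<in> Units G" "v \<in> Units G" "x \<in> carrier G"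
  shows "bdiv_equiv G x (u \<otimes> x \<otimes> v)"
proof -
  have "inv u \<otimes> (u \<otimes> x \<otimes> v) \<otimes> inv v = (inv u \<otimes> u) \<otimes> x \<otimes> (v \<otimes> inv v)"
    using assms Units_closed by (simp add: m_assoc del: Units_l_inv Units_r_inv)
  then have "x = inv u \<otimes> (u \<otimes> x \<otimes> v) \<otimes> inv v" using assms by simp
  then show ?thesis
    unfolding bdiv_equiv_def bdivides_def using assms Units_closed Units_inv_closed by blast
qed

lemma Units_bdivides:
  assumes "u \<in> Units G" "x \<in> carrier G"
  shows "bdivides G u x"
proof (rule bdividesI[of \<one> "inv u \<otimes> x"])
  show "x = \<one> \<otimes> u \<otimes> (inv u \<otimes> x)"
    using assms by (simp add: m_assoc[symmetric] Units_closed)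
qed (use assms in auto)

section \<open>The preorder on words\<close>

lemma word_le_refl: "set as \<subseteq> carrier G \<Longrightarrow> word_le G as as"
  unfolding word_le_def by (rule exI[of _ id]) (auto intro!: bdiv_equiv_refl dest: nth_mem)

lemma word_le_trans:
  assumes "set as \<subseteq> carrier G" "set cs \<subseteq> carrier G" "word_le G as bs" "word_le G bs cs"
  shows "word_le G as cs"
proof -
  obtain \<sigma> where \<sigma>: "inj_on \<sigma> {..<length as}" "\<sigma> ` {..<length as} \<subseteq> {..<length bs}"
    "\<forall>i<length as. bdiv_equiv G (as ! i) (bs ! \<sigma> i)"
    using assms(3) unfolding word_le_def by blast
  obtain \<tau> where \<tau>: "inj_on \<tau> {..<length bs}" "\<tau> ` {..<length bs} \<subseteq> {..<length cs}"
    "\<forall>i<length bs. bdiv_equiv G (bs ! i) (cs ! \<tau> i)"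
    using assms(4) unfolding word_le_def by blast
  have "inj_on (\<tau> \<circ> \<sigma>) {..<length as}"
    using \<sigma>(1,2) \<tau>(1) by (meson comp_inj_on inj_on_subset)
  moreover have "(\<tau> \<circ> \<sigma>) ` {..<length as} \<subseteq> {..<length cs}"
    using \<sigma>(2) \<tau>(2) by (auto simp: image_subset_iff)
  moreover have "bdiv_equiv G (as ! i) (cs ! (\<tau> \<circ> \<sigma>) i)" if i: "i < length as" for i
  proof -
    have j: "\<sigma> i < length bs" using \<sigma>(2) i by auto
    then have "\<tau> (\<sigma> i) < length cs" using \<tau>(2) by auto
    then have "as ! i \<in> carrier G" "cs ! \<tau> (\<sigma> i) \<in> carrier G"
      using assms(1,2) i nth_mem by blast+
    then show ?thesis using bdiv_equiv_trans \<sigma>(3) \<tau>(3) i j by (metis comp_apply)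
  qed
  ultimately show ?thesis unfolding word_le_def by blast
qed

lemma word_le_length:
  assumes "word_le G as bs"
  shows "length as \<le> length bs"
proof -
  obtain \<sigma> where "inj_on \<sigma> {..<length as}" "\<sigma> ` {..<length as} \<subseteq> {..<length bs}"
    using assms unfolding word_le_def by blast
  then show ?thesis using card_inj_on_le[of \<sigma> "{..<length as}" "{..<length bs}"] by simp
qed

text \<open>Between index sets of equal size the injection \<open>\<sigma>\<close> is a bijection,
  and its inverse matches the letters in the other direction.\<close>

lemma word_le_sym_of_length:
  assumes "word_le G as bs" "length as = length bs"
  shows "word_le G bs as"
proof -
  obtain \<sigma> where \<sigma>: "inj_on \<sigma> {..<length as}" "\<sigma> ` {..<length as} \<subseteq> {..<length bs}"
    "\<forall>i<length as. bdiv_equiv G (as ! i) (bs ! \<sigma> i)"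
    using assms(1) unfolding word_le_def by blast
  then have bij: "bij_betw \<sigma> {..<length as} {..<length bs}"
    using assms(2) by (simp add: bij_betw_def endo_inj_surj)
  let ?\<tau> = "the_inv_into {..<length as} \<sigma>"
  have \<tau>: "bij_betw ?\<tau> {..<length bs} {..<length as}" using bij by (rule bij_betw_the_inv_into)
  have "bdiv_equiv G (bs ! j) (as ! ?\<tau> j)" if j: "j < length bs" for j
  proof -
    have "?\<tau> j < length as" using \<tau> j bij_betwE by blast
    moreover have "\<sigma> (?\<tau> j) = j"
      using bij j f_the_inv_into_f_bij_betw[OF bij] by blast
    ultimately show ?thesis using \<sigma>(3) bdiv_equiv_sym by metis
  qed
  then show ?thesis using \<tau> unfolding word_le_def bij_betw_def by blast
qed

section \<open>Minimal factorizations\<close>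

lemma bdiv_factorizations_carrier:
  "as \<in> bdiv_factorizations G x \<Longrightarrow> set as \<subseteq> carrier G"
  unfolding bdiv_factorizations_def bdiv_irreducibles_def bdiv_nonunits_def by blast

text \<open>A factorization below one of least length is no longer than it, hence of the same
  length, and then the comparison reverses.\<close>

lemma minimal_factorizations_nonempty:
  assumes "bdiv_factorizations G x \<noteq> {}"
  shows "minimal_factorizations G x \<noteq> {}"
proof -
  obtain as where as: "as \<in> bdiv_factorizations G x"
    "\<And>bs. bs \<in> bdiv_factorizations G x \<Longrightarrow> length as \<le> length bs"
    using ex_has_least_nat[of "\<lambda>as. as \<in> bdiv_factorizations G x" _ length] assms by blast
  have "word_le G as bs" if "bs \<in> bdiv_factorizations G x" "word_le G bs as" for bs
    using word_le_sym_of_length[OF that(2)] word_le_length[OF that(2)] as(2)[OF that(1)] by simp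
  then show ?thesis using as(1) unfolding minimal_factorizations_def by blast
qed

lemma equiv_word_equiv_on:
  assumes "\<And>as. as \<in> Z \<Longrightarrow> set as \<subseteq> carrier G"
  shows "equiv Z (word_equiv_on G Z)"
proof (rule equivI)
  show "word_equiv_on G Z \<subseteq> Z \<times> Z" unfolding word_equiv_on_def by blast
  show "refl_on Z (word_equiv_on G Z)"
    using word_le_refl assms unfolding word_equiv_on_def refl_on_def by blast
  show "sym (word_equiv_on G Z)" unfolding word_equiv_on_def sym_def by blast
  show "trans (word_equiv_on G Z)"
    using word_le_trans assms unfolding word_equiv_on_def trans_def by blast
qed

text \<open>Infinitely many classes would give an infinite sequence of pairwise inequivalent minimal
  factorizations. Since \<open>word_le\<close> ignores the order of letters, Dickson's lemma finds
  an earlier one below a later one, and minimality of the later one makes them equivalent.\<close>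

lemma finite_minimal_classes:
  assumes "finite A" "A \<subseteq> carrier G" "Z \<subseteq> minimal_factorizations G x"
    and cls: "\<And>as a. as \<in> Z \<Longrightarrow> a \<in> set as \<Longrightarrow> \<exists>b\<in>A. bdiv_equiv G a b"
  shows "finite (Z // word_equiv_on G Z)"
proof (rule ccontr)
  have fac: "Z \<subseteq> bdiv_factorizations G x"
    using assms(3) unfolding minimal_factorizations_def by blast
  have car: "set as \<subseteq> carrier G" if "as \<in> Z" for as
    using that fac bdiv_factorizations_carrier by blast
  have eqv: "equiv Z (word_equiv_on G Z)" using equiv_word_equiv_on car by blast
  \<comment> \<open>\<open>c\<close> replaces a letter by an equivalent element of \<open>A\<close>;
    words become multisets over a finite alphabet, whose inclusion implies
    \<open>word_le\<close>.\<close>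
  define c where "c a = (SOME b. b \<in> A \<and> bdiv_equiv G a b)" for a
  have c: "c a \<in> A \<and> bdiv_equiv G a (c a)" if "as \<in> Z" "a \<in> set as" for as a
    unfolding c_def by (rule someI_ex) (use cls[OF that] in blast)
  have le: "word_le G as bs"
    if ab: "as \<in> Z" "bs \<in> Z" "mset (map c as) \<subseteq># mset (map c bs)" for as bs
  proof -
    obtain \<sigma> where \<sigma>: "inj_on \<sigma> {..<length as}" "\<sigma> ` {..<length as} \<subseteq> {..<length bs}"
      "\<forall>i<length as. map c as ! i = map c bs ! \<sigma> i"
      using mset_subset_Ex_inj[OF ab(3)] by auto
    have "bdiv_equiv G (as ! i) (bs ! \<sigma> i)" if i: "i < length as" for i
    proof -
      have j: "\<sigma> i < length bs" using \<sigma>(2) i by auto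
      have "c (as ! i) = c (bs ! \<sigma> i)" using \<sigma>(3) i j by (metis nth_map)
      moreover have "bdiv_equiv G (as ! i) (c (as ! i))" using c ab(1) i by simp
      moreover have "bdiv_equiv G (bs ! \<sigma> i) (c (bs ! \<sigma> i))" using c ab(2) j by simp
      moreover have "as ! i \<in> carrier G" "bs ! \<sigma> i \<in> carrier G"
        using car ab(1,2) i j nth_mem by blast+
      ultimately show ?thesis by (metis bdiv_equiv_sym bdiv_equiv_trans)
    qed
    then show ?thesis using \<sigma>(1,2) unfolding word_le_def by blast
  qed
  assume "infinite (Z // word_equiv_on G Z)"
  then obtain f :: "nat \<Rightarrow> 'a list set" where f: "inj f" "range f \<subseteq> Z // word_equiv_on G Z"
    using infinite_countable_subset by blast
  have "\<forall>n. \<exists>r. r \<in> Z \<and> f n = word_equiv_on G Z `` {r}"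
    using f(2) by (auto elim!: quotientE simp: image_subset_iff)
  then obtain r where r: "\<And>n. r n \<in> Z" "\<And>n. f n = word_equiv_on G Z `` {r n}" by metis
  have "set_mset (mset (map c (r n))) \<subseteq> A" for n using c r(1) by auto
  then obtain i j where ij: "i < j" "mset (map c (r i)) \<subseteq># mset (map c (r j))"
    using dickson_mset[OF assms(1), of "\<lambda>n. mset (map c (r n))"] by blast
  have le1: "word_le G (r i) (r j)" using le r(1) ij(2) by blast
  \<comment> \<open>Both words factor the same \<open>x\<close>, so \<open>r i\<close> is among the
    words against which the minimality of \<open>r j\<close> is tested.\<close>
  have "r j \<in> minimal_factorizations G x" "r i \<in> bdiv_factorizations G x"
    using assms(3) fac r(1) by blast+
  with le1 have "word_le G (r j) (r i)" unfolding minimal_factorizations_def by blast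
  with le1 have "(r i, r j) \<in> word_equiv_on G Z" using r(1) unfolding word_equiv_on_def by blast
  then have "f i = f j" using equiv_class_eq[OF eqv] r(2) by simp
  then show False using f(1) ij(1) by (simp add: inj_eq)
qed

end

section \<open>Acyclic monoids\<close>

locale bdiv_acyclic = monoid +
  assumes acyclic: "acyclic_monoid G"
begin

section \<open>Units and strict divisibility\<close>

lemma acyclicD:
  assumes "u \<in> carrier G" "v \<in> carrier G" "x \<in> carrier G" "u \<otimes> x \<otimes> v = x"
  shows "u \<in> Units G" "v \<in> Units G"
  using acyclic assms unfolding acyclic_monoid_def by blast+

text \<open>With the inverse of the product, each factor becomes invertible on one side. A relation
  \<open>x \<otimes> z = \<one>\<close> is acyclicity's forbidden equation at the element
  \<open>\<one>\<close> unless \<open>x\<close> and \<open>z\<close> are units.\<close>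

lemma Units_multD:
  assumes "x \<in> carrier G" "y \<in> carrier G" "x \<otimes> y \<in> Units G"
  shows "x \<in> Units G" "y \<in> Units G"
proof -
  let ?w = "inv (x \<otimes> y)"
  have "x \<otimes> \<one> \<otimes> (y \<otimes> ?w) = \<one>" using assms by (simp add: m_assoc[symmetric])
  then show "x \<in> Units G" using acyclicD[of x "y \<otimes> ?w" \<one>] assms by simp
  have "(?w \<otimes> x) \<otimes> \<one> \<otimes> y = \<one>" using assms by (simp add: m_assoc)
  then show "y \<in> Units G" using acyclicD[of "?w \<otimes> x" y \<one>] assms by simp
qed

text \<open>If \<open>x = s \<otimes> (u \<otimes> x \<otimes> v) \<otimes> t\<close>, then
  \<open>s \<otimes> u\<close> and \<open>v \<otimes> t\<close> are units by acyclicity, and factors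
  of units are units. Thus multiplying by a non-unit moves strictly up in divisibility.\<close>

lemma bdivides_mult_selfD:
  assumes "u \<in> carrier G" "v \<in> carrier G" "x \<in> carrier G" "bdivides G (u \<otimes> x \<otimes> v) x"
  shows "u \<in> Units G" "v \<in> Units G"
proof -
  obtain s t where st: "s \<in> carrier G" "t \<in> carrier G" "x = s \<otimes> (u \<otimes> x \<otimes> v) \<otimes> t"
    using assms(4) unfolding bdivides_def by blast
  then have "(s \<otimes> u) \<otimes> x \<otimes> (v \<otimes> t) = x" using assms by (simp add: m_assoc)
  then have "s \<otimes> u \<in> Units G" "v \<otimes> t \<in> Units G"
    using acyclicD[of "s \<otimes> u" "v \<otimes> t" x] assms st by simp_all
  then show "u \<in> Units G" "v \<in> Units G" using Units_multD st assms by blast+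
qed

lemma mult_bdivides_leftD:
  "x \<in> carrier G \<Longrightarrow> y \<in> carrier G \<Longrightarrow> bdivides G (x \<otimes> y) x \<Longrightarrow> y \<in> Units G"
  using bdivides_mult_selfD(2)[of \<one> y x] by simp

lemma mult_bdivides_rightD:
  "x \<in> carrier G \<Longrightarrow> y \<in> carrier G \<Longrightarrow> bdivides G (x \<otimes> y) y \<Longrightarrow> x \<in> Units G"
  using bdivides_mult_selfD(1)[of x \<one> y] by simp

text \<open>Divisors of \<open>\<one>\<close> are factors of a unit, so \<open>Units_multD\<close>
  applies twice; conversely a unit divides everything.\<close>

lemma bdiv_units_eq: "bdiv_units G = Units G"
proof
  show "bdiv_units G \<subseteq> Units G"
  proof
    fix x assume "x \<in> bdiv_units G"
    then obtain u v where uv: "x \<in> carrier G" "u \<in> carrier G" "v \<in> carrier G" "\<one> = u \<otimes> x \<otimes> v"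
      unfolding bdiv_units_def bdiv_equiv_def bdivides_def by blast
    then have "u \<otimes> x \<in> Units G"
      using Units_multD(1)[of "u \<otimes> x" v] by (metis Units_one_closed m_closed)
    then show "x \<in> Units G" using Units_multD(2) uv by blast
  qed
  show "Units G \<subseteq> bdiv_units G"
    using Units_bdivides bdividesI[of _ \<one> _ \<one>]
    by (auto simp: bdiv_units_def bdiv_equiv_def Units_closed)
qed

lemma bdiv_nonunits_eq: "bdiv_nonunits G = carrier G - Units G"
  by (simp add: bdiv_nonunits_def bdiv_units_eq)

text \<open>Each factor of a product of two non-units divides it strictly, so the divisibility
  conditions in the definition of irreducibles hold automatically.\<close>

lemma bdiv_irreducibles_eq_atoms: "bdiv_irreducibles G = bdiv_atoms G"
proof
  show "bdiv_atoms G \<subseteq> bdiv_irreducibles G"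
    unfolding bdiv_atoms_def bdiv_irreducibles_def by blast
  show "bdiv_irreducibles G \<subseteq> bdiv_atoms G"
  proof
    fix a assume a: "a \<in> bdiv_irreducibles G"
    have "a \<noteq> x \<otimes> y" if "x \<in> bdiv_nonunits G" "y \<in> bdiv_nonunits G" for x y
      using a that bdivides_mult_left[of x y] bdivides_mult_right[of x y]
        mult_bdivides_leftD[of x y] mult_bdivides_rightD[of x y]
      unfolding bdiv_irreducibles_def bdiv_nonunits_eq by blast
    with a show "a \<in> bdiv_atoms G" unfolding bdiv_atoms_def bdiv_irreducibles_def by blast
  qed
qed

section \<open>Atoms and their products\<close>

lemma bdiv_atoms_iff:
  "a \<in> bdiv_atoms G \<longleftrightarrow> a \<in> carrier G \<and> a \<notin> Units G \<and>
    (\<forall>x\<in>carrier G. \<forall>y\<in>carrier G. a = x \<otimes> y \<longrightarrow> x \<in> Units G \<or> y \<in> Units G)"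
  unfolding bdiv_atoms_def bdiv_nonunits_eq by blast

lemma bdiv_atomsD:
  "x \<otimes> y \<in> bdiv_atoms G \<Longrightarrow> x \<in> carrier G \<Longrightarrow> y \<in> carrier G \<Longrightarrow> x \<in> Units G \<or> y \<in> Units G"
  unfolding bdiv_atoms_iff by blast

text \<open>The unit moves to the other side: \<open>u \<otimes> a = x \<otimes> y\<close> gives
  \<open>a = (inv u \<otimes> x) \<otimes> y\<close>. This lets a word of atoms absorb a unit into
  its first letter.\<close>

lemma atom_mult_Units_left:
  assumes "u \<in> Units G" "a \<in> bdiv_atoms G"
  shows "u \<otimes> a \<in> bdiv_atoms G"
proof -
  have a: "a \<in> carrier G" "a \<notin> Units G" "u \<in> carrier G"
    using assms Units_closed unfolding bdiv_atoms_iff by blast+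
  have "x \<in> Units G \<or> y \<in> Units G"
    if xy: "x \<in> carrier G" "y \<in> carrier G" "u \<otimes> a = x \<otimes> y" for x y
  proof -
    have "inv u \<otimes> (u \<otimes> a) = (inv u \<otimes> x) \<otimes> y" using xy assms by (simp add: m_assoc)
    then have "a = (inv u \<otimes> x) \<otimes> y" using a assms by (simp add: m_assoc[symmetric])
    then have "inv u \<otimes> x \<in> Units G \<or> y \<in> Units G"
      using bdiv_atomsD[of "inv u \<otimes> x" y] assms xy by simp
    then show ?thesis using Units_multD(2)[of "inv u" x] xy assms by auto
  qed
  then show ?thesis using a Units_multD(2)[of u a] unfolding bdiv_atoms_iff by auto
qed

lemma atom_mult_Units_right:
  assumes "u \<in> Units G" "a \<in> bdiv_atoms G"
  shows "a \<otimes> u \<in> bdiv_atoms G"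
proof -
  have a: "a \<in> carrier G" "a \<notin> Units G" "u \<in> carrier G"
    using assms Units_closed unfolding bdiv_atoms_iff by blast+
  have "x \<in> Units G \<or> y \<in> Units G"
    if xy: "x \<in> carrier G" "y \<in> carrier G" "a \<otimes> u = x \<otimes> y" for x y
  proof -
    have "(a \<otimes> u) \<otimes> inv u = x \<otimes> (y \<otimes> inv u)" using xy assms by (simp add: m_assoc)
    then have "a = x \<otimes> (y \<otimes> inv u)" using a assms by (simp add: m_assoc)
    then have "x \<in> Units G \<or> y \<otimes> inv u \<in> Units G"
      using bdiv_atomsD[of x "y \<otimes> inv u"] assms xy by simp
    then show ?thesis using Units_multD(1)[of y "inv u"] xy assms by auto
  qed
  then show ?thesis using a Units_multD(1)[of a u] unfolding bdiv_atoms_iff by auto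
qed

text \<open>The empty word contributes \<open>\<one>\<close>, but no other unit is a product of
  atoms; hence the union with \<open>Units G\<close> below.\<close>

definition atomic_products :: "'a set" where
  "atomic_products = {word_prod G as |as. set as \<subseteq> bdiv_atoms G}"

lemma bdiv_atoms_carrier: "bdiv_atoms G \<subseteq> carrier G"
  unfolding bdiv_atoms_iff subset_iff by blast

lemma atomic_products_carrier: "atomic_products \<subseteq> carrier G"
  unfolding atomic_products_def using bdiv_atoms_carrier by (auto intro!: word_prod_closed)

lemma atom_in_atomic_products: "a \<in> bdiv_atoms G \<Longrightarrow> a \<in> atomic_products"
  unfolding atomic_products_def using bdiv_atoms_carrier
  by (intro CollectI exI[of _ "[a]"]) auto

lemma atomic_products_mult:
  assumes "v \<in> atomic_products" "w \<in> atomic_products"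
  shows "v \<otimes> w \<in> atomic_products"
proof -
  obtain as bs where ab: "set as \<subseteq> bdiv_atoms G" "set bs \<subseteq> bdiv_atoms G"
    "v = word_prod G as" "w = word_prod G bs"
    using assms unfolding atomic_products_def by blast
  then have "v \<otimes> w = word_prod G (as @ bs)"
    using word_prod_append[of as bs] bdiv_atoms_carrier by auto
  with ab show ?thesis unfolding atomic_products_def by (intro CollectI exI[of _ "as @ bs"]) auto
qed

text \<open>A unit multiplying from the left is absorbed by the first letter of a word, one from the
  right by the last letter; with the empty word the product is the unit itself.\<close>

lemma submonoid_atomic: "submonoid (Units G \<union> atomic_products) G"
proof
  show "Units G \<union> atomic_products \<subseteq> carrier G" using atomic_products_carrier Units_closed by blast
  show "\<one> \<in> Units G \<union> atomic_products" by simp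
  have left: "u \<otimes> w \<in> Units G \<union> atomic_products"
    if uw: "u \<in> Units G" "w \<in> atomic_products" for u w
  proof -
    obtain as where as: "set as \<subseteq> bdiv_atoms G" "w = word_prod G as"
      using uw(2) unfolding atomic_products_def by blast
    show ?thesis
    proof (cases as)
      case Nil
      then show ?thesis using as uw(1) Units_closed by simp
    next
      case (Cons b bs)
      then have "set bs \<subseteq> carrier G" "b \<in> carrier G" "u \<in> carrier G"
        using as uw(1) bdiv_atoms_carrier Units_closed by auto
      then have "u \<otimes> w = word_prod G ((u \<otimes> b) # bs)"
        using as Cons by (simp add: m_assoc)
      moreover have "set ((u \<otimes> b) # bs) \<subseteq> bdiv_atoms G"
        using as Cons uw(1) atom_mult_Units_left by auto
      ultimately show ?thesis unfolding atomic_products_def by blast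
    qed
  qed
  have right: "w \<otimes> u \<in> Units G \<union> atomic_products"
    if uw: "u \<in> Units G" "w \<in> atomic_products" for u w
  proof -
    obtain as where as: "set as \<subseteq> bdiv_atoms G" "w = word_prod G as"
      using uw(2) unfolding atomic_products_def by blast
    show ?thesis
    proof (cases as rule: rev_cases)
      case Nil
      then show ?thesis using as uw(1) Units_closed by simp
    next
      case (snoc bs b)
      then have car: "set bs \<subseteq> carrier G" "b \<in> carrier G" "u \<in> carrier G"
        using as uw(1) bdiv_atoms_carrier Units_closed by auto
      then have "w \<otimes> u = word_prod G (bs @ [b \<otimes> u])"
        using as snoc by (simp add: m_assoc word_prod_append)
      moreover have "set (bs @ [b \<otimes> u]) \<subseteq> bdiv_atoms G"
        using as snoc uw(1) atom_mult_Units_right by auto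
      ultimately show ?thesis unfolding atomic_products_def by blast
    qed
  qed
  show "v \<otimes> w \<in> Units G \<union> atomic_products"
    if "v \<in> Units G \<union> atomic_products" "w \<in> Units G \<union> atomic_products" for v w
    using that left right atomic_products_mult by blast
qed

text \<open>
  The set of those \<open>w\<close> that lie in \<open>P\<close> as soon as they divide \<open>a\<close> is again a submonoid; this replaces
  any bookkeeping of the generators that occur in a given divisor of \<open>a\<close>.
\<close>

lemma submonoid_conditional:
  assumes "submonoid P G"
  shows "submonoid {w \<in> carrier G. bdivides G w a \<longrightarrow> w \<in> P} G"
proof
  interpret P: submonoid P G by fact
  show "{w \<in> carrier G. bdivides G w a \<longrightarrow> w \<in> P} \<subseteq> carrier G" by blast
  show "\<one> \<in> {w \<in> carrier G. bdivides G w a \<longrightarrow> w \<in> P}" by simp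
  fix v w
  assume vw: "v \<in> {w \<in> carrier G. bdivides G w a \<longrightarrow> w \<in> P}"
    "w \<in> {w \<in> carrier G. bdivides G w a \<longrightarrow> w \<in> P}"
  show "v \<otimes> w \<in> {w \<in> carrier G. bdivides G w a \<longrightarrow> w \<in> P}"
    using vw bdivides_trans[OF _ bdivides_mult_left[of v w], of a]
      bdivides_trans[OF _ bdivides_mult_right[of v w], of a] by auto
qed

text \<open>
  A generator that does not divide \<open>x\<close> is a product of divisors of \<open>x\<close>, all of them strict divisors
  of it; a generator that divides \<open>x\<close> and is neither a unit nor an atom splits into two strict
  divisors that lie in the generated submonoid.
\<close>

lemma generators_atomic:
  assumes "finite A" "A \<subseteq> carrier G"
    and gen: "divisor_submonoid G x = submonoid_generated G (Units G <#> A <#> Units G)"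
    and A: "A \<subseteq> divisor_submonoid G x" and x: "x \<in> carrier G"
  shows "A \<subseteq> Units G \<union> atomic_products"
proof
  let ?P = "Units G \<union> atomic_products"
  \<comment> \<open>Strict divisibility on \<open>A\<close> is transitive and irreflexive, hence
    acyclic, and the finiteness of \<open>A\<close> makes it well founded.\<close>
  let ?r = "{(b, a). a \<in> A \<and> b \<in> A \<and> bdivides G b a \<and> \<not> bdivides G a b}"
  have "trans ?r"
    using assms(2) bdivides_trans unfolding trans_def by blast
  then have "acyclic ?r" unfolding acyclic_def by (auto simp: trancl_id)
  moreover have "finite ?r" by (rule finite_subset[of _ "A \<times> A"]) (use assms(1) in auto)
  ultimately have wf: "wf ?r" by (rule finite_acyclic_wf[rotated])
  interpret P: submonoid ?P G by (rule submonoid_atomic)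
  fix a assume "a \<in> A"
  with wf show "a \<in> ?P"
  proof (induction a rule: wf_induct_rule)
    case (less a)
    then have a: "a \<in> carrier G" using assms(2) by blast
    \<comment> \<open>\<open>d\<close> need not lie in \<open>A\<close>, so the induction hypothesis
      does not apply to it directly. It is a product of elements
      \<open>u \<otimes> b \<otimes> v\<close>, and each such \<open>b\<close> divides
      \<open>d\<close>; if \<open>a\<close> divided \<open>b\<close>, it would divide
      \<open>d\<close>. Hence every \<open>b\<close> involved lies strictly below
      \<open>a\<close>.\<close>
    have strict: "d \<in> ?P"
      if d: "d \<in> divisor_submonoid G x" "d \<in> carrier G" "bdivides G d a" "\<not> bdivides G a d" for d
    proof -
      let ?Q = "{w \<in> carrier G. bdivides G w d \<longrightarrow> w \<in> ?P}"
      have "w \<in> ?Q" if w': "w \<in> Units G <#> A <#> Units G" for w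
      proof -
        obtain u b v where w: "u \<in> Units G" "b \<in> A" "v \<in> Units G" "w = u \<otimes> b \<otimes> v"
          using w' unfolding set_mult_def by blast
        have car: "u \<in> carrier G" "b \<in> carrier G" "v \<in> carrier G"
          using w assms(2) Units_closed by blast+
        have "w \<in> ?P" if "bdivides G w d"
        proof -
          have "bdivides G b w" using car w(4) by (intro bdividesI)
          then have "bdivides G b d" using bdivides_trans that car by blast
          then have "bdivides G b a" "\<not> bdivides G a b"
            using bdivides_trans d car a by blast+
          then have "b \<in> ?P" using less w(2) by blast
          then show ?thesis using P.m_closed[OF P.m_closed, of u b v] w by blast
        qed
        then show ?thesis using car w(4) by simp
      qed
      then have "divisor_submonoid G x \<subseteq> ?Q"
        unfolding gen by (intro submonoid_generated_minimal submonoid_conditional submonoid_atomic) blast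
      then show ?thesis using d bdivides_refl by blast
    qed
    show ?case
    proof (cases "bdivides G a x")
      case False
      let ?Q = "{w \<in> carrier G. bdivides G w a \<longrightarrow> w \<in> ?P}"
      \<comment> \<open>If \<open>a\<close> divided such a \<open>y\<close>, it would divide
        \<open>x\<close>; so a \<open>y\<close> that divides \<open>a\<close> divides it
        strictly.\<close>
      have "y \<in> ?Q" if "y \<in> carrier G" "bdivides G y x" for y
        using strict[OF divisor_submonoid_incl[OF that]] that False bdivides_trans[OF a _ that(2)] by blast
      then have "divisor_submonoid G x \<subseteq> ?Q"
        unfolding divisor_submonoid_def
        by (intro submonoid_generated_minimal submonoid_conditional submonoid_atomic) blast
      then show ?thesis using A less.prems a bdivides_refl by blast
    next
      case True
      show ?thesis
      proof (cases "a \<in> Units G \<or> a \<in> bdiv_atoms G")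
        case True
        then show ?thesis using atom_in_atomic_products by blast
      next
        case False
        then obtain y z where yz: "y \<in> carrier G" "z \<in> carrier G" "a = y \<otimes> z"
          "y \<notin> Units G" "z \<notin> Units G"
          using a unfolding bdiv_atoms_iff by blast
        have y: "bdivides G y a" "\<not> bdivides G a y"
          using yz bdivides_mult_left[of y z] mult_bdivides_leftD[of y z] by auto
        have z: "bdivides G z a" "\<not> bdivides G a z"
          using yz bdivides_mult_right[of y z] mult_bdivides_rightD[of y z] by auto
        \<comment> \<open>Both factors divide \<open>a\<close> and therefore \<open>x\<close>, which
          puts them in the divisor submonoid as \<open>strict\<close> requires.\<close>
        have "y \<in> ?P" "z \<in> ?P"
          using strict[OF divisor_submonoid_incl[OF _ bdivides_trans[OF _ _ True]]] yz y z by blast+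
        then show ?thesis unfolding yz(3) by (rule P.m_closed)
      qed
    qed
  qed
qed

text \<open>When an atom is a product of two elements, one is a unit and the other is an atom
  equivalent to the product. Being equivalent to an element of \<open>A\<close> if an atom therefore
  passes to products, and it holds for the generators.\<close>

lemma generated_atoms_equiv:
  assumes "A \<subseteq> carrier G" "a \<in> submonoid_generated G (Units G <#> A <#> Units G)"
    "a \<in> bdiv_atoms G"
  shows "\<exists>b\<in>A. bdiv_equiv G a b"
proof -
  let ?Q = "{w \<in> carrier G. w \<in> bdiv_atoms G \<longrightarrow> (\<exists>b\<in>A. bdiv_equiv G w b)}"
  have "submonoid ?Q G"
  proof
    show "?Q \<subseteq> carrier G" by blast
    show "\<one> \<in> ?Q" by (simp add: bdiv_atoms_iff)
    fix v w assume vw: "v \<in> ?Q" "w \<in> ?Q"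
    then have car: "v \<in> carrier G" "w \<in> carrier G" by blast+
    have "\<exists>b\<in>A. bdiv_equiv G (v \<otimes> w) b" if at: "v \<otimes> w \<in> bdiv_atoms G"
    proof -
      consider "v \<in> Units G" | "w \<in> Units G" using at car unfolding bdiv_atoms_iff by blast
      then obtain c where c: "c = v \<or> c = w" "bdiv_equiv G (v \<otimes> w) c" "c \<in> bdiv_atoms G"
      proof cases
        case 1
        have "w = inv v \<otimes> (v \<otimes> w)" using 1 car by (simp add: m_assoc[symmetric])
        then have "w \<in> bdiv_atoms G" using atom_mult_Units_left[OF Units_inv_Units[OF 1] at] by simp
        moreover have "bdiv_equiv G (v \<otimes> w) w"
          using bdiv_equiv_sym[OF bdiv_equiv_Units_mult[OF 1 Units_one_closed car(2)]] car by simp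
        ultimately show thesis using that by blast
      next
        case 2
        have "v = (v \<otimes> w) \<otimes> inv w" using 2 car by (simp add: m_assoc)
        then have "v \<in> bdiv_atoms G" using atom_mult_Units_right[OF Units_inv_Units[OF 2] at] by simp
        moreover have "bdiv_equiv G (v \<otimes> w) v"
          using bdiv_equiv_sym[OF bdiv_equiv_Units_mult[OF Units_one_closed 2 car(1)]] car by simp
        ultimately show thesis using that by blast
      qed
      then obtain b where "b \<in> A" "bdiv_equiv G c b" using vw by blast
      then show ?thesis using c(2) car assms(1) by (meson bdiv_equiv_trans m_closed subsetD)
    qed
    then show "v \<otimes> w \<in> ?Q" using car by simp
  qed
  moreover have "Units G <#> A <#> Units G \<subseteq> ?Q"
  proof
    fix w assume "w \<in> Units G <#> A <#> Units G"
    then obtain u b v where w: "u \<in> Units G" "b \<in> A" "v \<in> Units G" "w = u \<otimes> b \<otimes> v"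
      unfolding set_mult_def by blast
    then have "bdiv_equiv G w b" "w \<in> carrier G"
      using bdiv_equiv_sym[OF bdiv_equiv_Units_mult[OF w(1,3)]] assms(1) Units_closed by auto
    then show "w \<in> ?Q" using w(2) by blast
  qed
  ultimately show ?thesis using submonoid_generated_minimal assms(2,3) by blast
qed

text \<open>Units divide \<open>x\<close>, so all of them lie in
  \<open>divisor_submonoid G x\<close>; by \<open>bdiv_units_eq\<close> the set \<open>U\<close> of
  the definition is then \<open>Units G\<close>.\<close>

lemma weakly_lfguE:
  assumes "weakly_lfgu G" "x \<in> carrier G" "x \<notin> Units G"
  obtains A where "finite A" "A \<subseteq> carrier G" "A \<subseteq> divisor_submonoid G x"
    "divisor_submonoid G x = submonoid_generated G (Units G <#> A <#> Units G)"
proof -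
  have "Units G \<subseteq> divisor_submonoid G x"
    using assms(2) by (auto intro: divisor_submonoid_incl Units_bdivides Units_closed)
  then have U: "bdiv_units G \<inter> divisor_submonoid G x = Units G" using bdiv_units_eq by blast
  obtain A where A: "finite A" "A \<subseteq> divisor_submonoid G x"
    "divisor_submonoid G x = submonoid_generated G (Units G <#> A <#> Units G)"
    using assms unfolding weakly_lfgu_def Let_def bdiv_nonunits_eq by (metis DiffI U)
  have "divisor_submonoid G x \<subseteq> carrier G"
    unfolding divisor_submonoid_def
    by (rule submonoid_generated_minimal[OF carrier_submonoid]) blast
  then show thesis using that A by blast
qed

lemma minimal_atomic_eq: "minimal_atomic_factorizations G x = minimal_factorizations G x"
  unfolding minimal_atomic_factorizations_def minimal_factorizations_def bdiv_factorizations_def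
    bdiv_irreducibles_eq_atoms by blast

theorem weakly_lfgu_imp_FmF_atomic:
  assumes "weakly_lfgu G"
  shows "FmF_atomic G"
  unfolding FmF_atomic_def Let_def
proof (intro ballI conjI)
  fix x assume "x \<in> bdiv_nonunits G"
  then have x: "x \<in> carrier G" "x \<notin> Units G" unfolding bdiv_nonunits_eq by blast+
  obtain A where A: "finite A" "A \<subseteq> carrier G" "A \<subseteq> divisor_submonoid G x"
    "divisor_submonoid G x = submonoid_generated G (Units G <#> A <#> Units G)"
    using weakly_lfguE assms x by blast
  interpret P: submonoid "Units G \<union> atomic_products" G by (rule submonoid_atomic)
  have AP: "A \<subseteq> Units G \<union> atomic_products" using generators_atomic A x(1) by blast
  have "Units G <#> A <#> Units G \<subseteq> Units G \<union> atomic_products"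
  proof
    fix w assume "w \<in> Units G <#> A <#> Units G"
    then obtain u b v where "u \<in> Units G" "b \<in> A" "v \<in> Units G" "w = u \<otimes> b \<otimes> v"
      unfolding set_mult_def by blast
    then show "w \<in> Units G \<union> atomic_products" 
      using AP P.m_closed[OF P.m_closed, of u b v] by blast
  qed
  then have "divisor_submonoid G x \<subseteq> Units G \<union> atomic_products"
    unfolding A(4) by (rule submonoid_generated_minimal[OF submonoid_atomic])
  \<comment> \<open>\<open>x\<close> divides itself and is not a unit, so only the products of atoms
    remain.\<close>
  then have "x \<in> atomic_products"
    using divisor_submonoid_incl[OF x(1) bdivides_refl[OF x(1)]] x(2) by blast
  then have "bdiv_factorizations G x \<noteq> {}"
    unfolding atomic_products_def bdiv_factorizations_def bdiv_irreducibles_eq_atoms by blast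
  then show "minimal_atomic_factorizations G x \<noteq> {}"
    using minimal_factorizations_nonempty minimal_atomic_eq by simp
  let ?Z = "minimal_atomic_factorizations G x"
  \<comment> \<open>The letters are atoms dividing \<open>x\<close>, so they lie in the generated
    submonoid and each is equivalent to an element of the finite set \<open>A\<close>, the alphabet
    for Dickson's lemma.\<close>
  have "\<exists>b\<in>A. bdiv_equiv G a b" if as: "as \<in> ?Z" "a \<in> set as" for as a
  proof -
    have "set as \<subseteq> bdiv_atoms G" "word_prod G as = x"
      using as(1) unfolding minimal_atomic_factorizations_def minimal_factorizations_def
        bdiv_factorizations_def by blast+
    then have "a \<in> bdiv_atoms G" "bdivides G a x"
      using as(2) word_prod_letter_bdivides[of as a] bdiv_atoms_carrier by blast+
    moreover from this have "a \<in> divisor_submonoid G x"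
      using divisor_submonoid_incl[of a G x] bdiv_atoms_carrier by auto
    ultimately show ?thesis using generated_atoms_equiv[OF A(2)] A(4) by simp
  qed
  then show "finite (?Z // word_equiv_on G ?Z)"
    using finite_minimal_classes[OF A(1,2), of ?Z x] by (simp add: minimal_atomic_eq)
qed

end

theorem corollary5p2:
  fixes H :: "('a, 'b) monoid_scheme"
  assumes "monoid H"
    and "acyclic_monoid H"
    and "weakly_lfgu H"
  shows "FmF_atomic H"
proof -
  interpret bdiv_acyclic H
    using assms(1,2) by (intro bdiv_acyclic.intro bdiv_acyclic_axioms.intro)
  show ?thesis using assms(3) by (rule weakly_lfgu_imp_FmF_atomic)
qed

end
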